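(* Let $n,l,k$ be positive integers. There exists a balanced generalized de Bruijn sequence with parameters $(n,l,k)$ if and only if $n$ is even and $k \geq \frac{n}{2^l}$.
   Context: A generalized de Bruijn sequence with parameters $(n,l,k)$ is a cyclic sequence of $n$ bits (elements of $\{0,1\}$) such that each binary string of length $l$ occurs at most $k$ times as a (cyclic) substring, i.e. among the $n$ cyclic windows $b_i b_{i+1}\cdots b_{i+l-1}$ (indices mod $n$), $i=0,\dots,n-1$. Such a sequence is called balanced if the number of $0$s equals the number of $1$s. *)

theory Defs
  imports Complex_Main
begin

text \<open>A cyclic sequence of \<open>n\<close> bits is represented by any list of length \<open>n\<close> that spells it out
  from some starting position (\<open>False\<close> is the bit 0, \<open>True\<close> the bit 1); all notions below are
  invariant under rotation of the list. Indices are taken modulo the length, so a window may be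
  longer than the sequence and wrap around several times.\<close>

definition cyclic_window :: "bool list \<Rightarrow> nat \<Rightarrow> nat \<Rightarrow> bool list" where
  "cyclic_window b l i = map (\<lambda>j. b ! ((i + j) mod length b)) [0..<l]"

definition generalized_de_bruijn :: "nat \<Rightarrow> nat \<Rightarrow> nat \<Rightarrow> bool list \<Rightarrow> bool" where
  "generalized_de_bruijn n l k b \<longleftrightarrow>
     length b = n \<and>
     (\<forall>w. length w = l \<longrightarrow> card {i. i < n \<and> cyclic_window b l i = w} \<le> k)"

definition balanced :: "bool list \<Rightarrow> bool" where
  "balanced b \<longleftrightarrow> count_list b False = count_list b True"

end

theory Submission
  imports Defs "HOL-Number_Theory.Cong"
begin

text \<open>Consider cyclic sequences of length \<open>m\<close> with \<open>2 ^ q \<le> m \<le> 2 ^ (q + 1)\<close> whose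
  \<open>(q + 1)\<close>-windows are distinct and whose \<open>q\<close>-windows cover all words. The preimages of such a
  sequence under Lempel's homomorphism form either one cycle of length \<open>2 m\<close> or two complementary
  cycles of length \<open>m\<close>, and are balanced in total. In the second case the two cycles can be spliced:
  at a common \<open>(q + 1)\<close>-word if there is one, and otherwise at a common \<open>q\<close>-word, which exists
  because together the cycles cover all \<open>(q + 1)\<close>-words. Odd lengths arise by inserting one bit into
  a constant window, which needs the constant \<open>(q + 2)\<close>-windows to be absent; that is arranged by
  starting from a sequence without the window \<open>0 \<dots> 0\<close>. By induction on \<open>q\<close> this gives balanced
  sequences with distinct \<open>l\<close>-windows for all even \<open>n \<le> 2 ^ l\<close>. Larger \<open>n\<close> follow by splicing
  in full de Bruijn sequences of length \<open>2 ^ l\<close>.\<close>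

section \<open>Windows of periodic sequences, and the concatenation of two cycles\<close>

definition window :: "(nat \<Rightarrow> bool) \<Rightarrow> nat \<Rightarrow> nat \<Rightarrow> bool list" where
  "window x p i = map (\<lambda>j. x (i + j)) [0..<p]"

definition periodic :: "nat \<Rightarrow> (nat \<Rightarrow> bool) \<Rightarrow> bool" where
  "periodic n x \<longleftrightarrow> 0 < n \<and> (\<forall>i. x (i + n) = x i)"

definition shift :: "nat \<Rightarrow> (nat \<Rightarrow> bool) \<Rightarrow> nat \<Rightarrow> bool" where
  "shift a x i = x (a + i)"

definition glue :: "nat \<Rightarrow> nat \<Rightarrow> (nat \<Rightarrow> bool) \<Rightarrow> (nat \<Rightarrow> bool) \<Rightarrow> nat \<Rightarrow> bool" where
  "glue n m x y i = (let r = i mod (n + m) in if r < n then x r else y (r - n))"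

lemma length_window [simp]: "length (window x p i) = p"
  by (simp add: window_def)

lemma window_eq_iff: "window x p i = window y p j \<longleftrightarrow> (\<forall>k<p. x (i + k) = y (j + k))"
  by (auto simp: window_def)

lemma window_eq_list_iff: "length w = p \<Longrightarrow> window x p i = w \<longleftrightarrow> (\<forall>k<p. x (i + k) = w ! k)"
  by (auto simp: window_def list_eq_iff_nth_eq)

lemma window_eq_replicate_iff: "window x p i = replicate p c \<longleftrightarrow> (\<forall>k<p. x (i + k) = c)"
  by (auto simp: window_eq_list_iff)

lemma window_shift: "window (shift a x) p i = window x p (a + i)"
  by (simp add: window_def shift_def add.assoc)

lemma periodic_add_mult: "periodic n x \<Longrightarrow> x (i + k * n) = x i"
  by (induction k) (auto simp: periodic_def add.assoc[symmetric] add.commute[of n])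

lemma periodic_cong:
  assumes "periodic n x" "[i = j] (mod n)"
  shows "x i = x j"
  using periodic_add_mult[OF assms(1)] assms(2)
  by (metis cong_def mod_div_mult_eq)

lemma periodic_window_cong:
  assumes "periodic n x" "[i = j] (mod n)"
  shows "window x p i = window x p j"
  unfolding window_eq_iff using assms periodic_cong cong_add_rcancel_nat by blast

lemma periodic_window_mod: "periodic n x \<Longrightarrow> window x p (i mod n) = window x p i"
  by (rule periodic_window_cong) (auto simp: cong_def)

lemma periodic_shift: "periodic n x \<Longrightarrow> periodic n (shift a x)"
  by (simp add: periodic_def shift_def add.assoc[symmetric])

lemma periodic_glue: "0 < n \<Longrightarrow> periodic (n + m) (glue n m x y)"
  by (simp add: periodic_def glue_def)

text \<open>Past its own block, each sequence meets the start of the other one, which agrees on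
  \<open>p\<close> bits with its own periodic continuation. Both claims share one strong induction
  because \<open>p\<close> may exceed a period, so that reading passes through several
  blocks.\<close>

lemma glue_eq:
  assumes x: "periodic n x" and y: "periodic m y" and eq: "window x p 0 = window y p 0"
  shows "i < n + p \<Longrightarrow> glue n m x y i = x i"
    and "i < m + p \<Longrightarrow> glue n m x y (n + i) = y i"
proof -
  let ?z = "glue n m x y"
  have n: "0 < n" "0 < m" using x y by (auto simp: periodic_def)
  have "(i < n + p \<longrightarrow> ?z i = x i) \<and> (i < m + p \<longrightarrow> ?z (n + i) = y i)"
  proof (induction i rule: less_induct)
    case (less i)
    have "?z i = x i" if i: "i < n + p"
    proof (cases "i < n")
      case True
      then show ?thesis by (simp add: glue_def)
    next
      case False
      define j where "j = i - n"
      have j: "i = n + j" "j < i" "j < p" using False n i by (auto simp: j_def)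
      have "?z (n + j) = y j" using less[of j] j by simp
      also have "\<dots> = x j" using eq j by (simp add: window_eq_iff)
      also have "\<dots> = x i" using x j by (simp add: periodic_def add.commute)
      finally show ?thesis using j by simp
    qed
    moreover have "?z (n + i) = y i" if i: "i < m + p"
    proof (cases "i < m")
      case True
      then show ?thesis by (simp add: glue_def)
    next
      case False
      define j where "j = i - m"
      have j: "i = m + j" "j < i" "j < p" using False n i by (auto simp: j_def)
      have "?z (n + i) = ?z (j + (n + m))" using j by (simp add: ac_simps)
      also have "\<dots> = ?z j" using periodic_glue[OF n(1), of m x y] unfolding periodic_def by blast
      also have "\<dots> = x j" using less[of j] j by simp
      also have "\<dots> = y j" using eq j by (simp add: window_eq_iff)
      also have "\<dots> = y i" using y j by (simp add: periodic_def add.commute)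
      finally show ?thesis .
    qed
    ultimately show ?case by blast
  qed
  then show "i < n + p \<Longrightarrow> ?z i = x i" "i < m + p \<Longrightarrow> ?z (n + i) = y i" by auto
qed

text \<open>A window of length at most \<open>p + 1\<close> starting inside a block ends at most
  \<open>p\<close> bits beyond it, which is the reach of \<open>glue_eq\<close>. Splicing at a
  common \<open>p\<close>-word thus preserves these windows.\<close>

lemma window_glue:
  assumes "periodic n x" "periodic m y" "window x p 0 = window y p 0" "q \<le> Suc p"
  shows "i < n \<Longrightarrow> window (glue n m x y) q i = window x q i"
    and "i < m \<Longrightarrow> window (glue n m x y) q (n + i) = window y q i"
  using glue_eq[OF assms(1-3)] assms(4) by (auto simp: window_eq_iff add.assoc)

lemma less_add_cases:
  fixes i n m :: nat
  assumes "i < n + m"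
  obtains "i < n" | j where "i = n + j" "j < m"
  using assms by (metis add_less_cancel_left le_Suc_ex not_less)

lemma card_less_add:
  "card {i. i < n + m \<and> P i} = card {i. i < n \<and> P i} + card {i. i < m \<and> P (n + i)}" for n m :: nat
proof -
  have "{i. i < n + m \<and> P i} = {i. i < n \<and> P i} \<union> (\<lambda>i. n + i) ` {i. i < m \<and> P (n + i)}"
    by (auto elim!: less_add_cases)
  also have "card \<dots> = card {i. i < n \<and> P i} + card ((\<lambda>i. n + i) ` {i. i < m \<and> P (n + i)})"
    by (rule card_Un_disjoint) auto
  also have "card ((\<lambda>i. n + i) ` {i. i < m \<and> P (n + i)}) = card {i. i < m \<and> P (n + i)}"
    by (rule card_image) auto
  finally show ?thesis .
qed

lemma card_glue_windows:
  assumes "periodic n x" "periodic m y" "window x p 0 = window y p 0" "q \<le> Suc p"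
  shows "card {i. i < n + m \<and> window (glue n m x y) q i = w} =
    card {i. i < n \<and> window x q i = w} + card {i. i < m \<and> window y q i = w}"
proof -
  have "{i. i < n \<and> window (glue n m x y) q i = w} = {i. i < n \<and> window x q i = w}"
    "{i. i < m \<and> window (glue n m x y) q (n + i) = w} = {i. i < m \<and> window y q i = w}"
    using window_glue[OF assms] by auto
  then show ?thesis by (simp add: card_less_add)
qed

lemma card_periodic_shift:
  fixes n a :: nat
  assumes "\<And>i. P (i + n) = P i"
  shows "card {i. i < n \<and> P (a + i)} = card {i. i < n \<and> P i}"
proof (induction a)
  case (Suc a)
  \<comment> \<open>Among \<open>n + 1\<close> consecutive positions, peel off the first or the last
    one; periodicity makes the two peeled terms equal.\<close>
  have "card {i. i < 1 + n \<and> P (a + i)} = card {i. i < n + 1 \<and> P (a + i)}" by simp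
  then have "card {i. i < 1 \<and> P (a + i)} + card {i. i < n \<and> P (a + (1 + i))} =
      card {i. i < n \<and> P (a + i)} + card {i. i < 1 \<and> P (a + (n + i))}"
    by (simp only: card_less_add)
  moreover have "{i. i < 1 \<and> P (a + (n + i))} = {i. i < 1 \<and> P (a + i)}"
    using assms[of a] by auto
  ultimately show ?case using Suc by simp
qed simp

section \<open>Counting the ones in a period\<close>

definition bit_balanced :: "nat \<Rightarrow> (nat \<Rightarrow> bool) \<Rightarrow> bool" where
  "bit_balanced n x \<longleftrightarrow> 2 * card {i. i < n \<and> x i} = n"

lemma card_glue:
  "card {i. i < n + m \<and> glue n m x y i} = card {i. i < n \<and> x i} + card {i. i < m \<and> y i}"
proof -
  have "{i. i < n \<and> glue n m x y i} = {i. i < n \<and> x i}"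
    "{i. i < m \<and> glue n m x y (n + i)} = {i. i < m \<and> y i}"
    by (auto simp: glue_def)
  then show ?thesis by (simp add: card_less_add)
qed

lemma card_shift: "periodic n x \<Longrightarrow> card {i. i < n \<and> shift a x i} = card {i. i < n \<and> x i}"
  using card_periodic_shift[of x n a] by (simp add: shift_def periodic_def)

lemma card_compl: "card {i. i < n \<and> x i} + card {i. i < n \<and> \<not> x i} = n" for n :: nat
proof -
  have "card ({i. i < n \<and> x i} \<union> {i. i < n \<and> \<not> x i}) = card {i. i < n \<and> x i} + card {i. i < n \<and> \<not> x i}"
    by (rule card_Un_disjoint) auto
  moreover have "{i. i < n \<and> x i} \<union> {i. i < n \<and> \<not> x i} = {..<n}" by auto
  ultimately show ?thesis by simp
qed

section \<open>Closed walks in the de Bruijn graph and their splicing\<close>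

text \<open>In terms of the de Bruijn graph whose vertices are the \<open>q\<close>-words and whose edges are the
  \<open>(q + 1)\<close>-words, \<open>tour n q x\<close> says that \<open>x\<close> spells a closed walk of \<open>n\<close> distinct edges
  through all vertices.\<close>

definition distinct_windows :: "nat \<Rightarrow> nat \<Rightarrow> (nat \<Rightarrow> bool) \<Rightarrow> bool" where
  "distinct_windows n p x \<longleftrightarrow> (\<forall>i j. window x p i = window x p j \<longrightarrow> [i = j] (mod n))"

definition tour :: "nat \<Rightarrow> nat \<Rightarrow> (nat \<Rightarrow> bool) \<Rightarrow> bool" where
  "tour n q x \<longleftrightarrow> periodic n x \<and> distinct_windows n (Suc q) x \<and>
     (\<forall>w. length w = q \<longrightarrow> (\<exists>i. window x q i = w))"

text \<open>A constant window is a loop of the de Bruijn graph; where it is absent, it can be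
  inserted at its vertex to lengthen a walk by one.\<close>

definition lacks_constant :: "nat \<Rightarrow> bool \<Rightarrow> (nat \<Rightarrow> bool) \<Rightarrow> bool" where
  "lacks_constant p c x \<longleftrightarrow> (\<forall>i. window x p i \<noteq> replicate p c)"

lemma distinct_windows_shift: "distinct_windows n p x \<Longrightarrow> distinct_windows n p (shift a x)"
  unfolding distinct_windows_def window_shift using cong_add_lcancel_nat by blast

lemma window_shift_covers:
  assumes "periodic n x" "\<exists>i. window x p i = w"
  shows "\<exists>i. window (shift a x) p i = w"
proof -
  obtain i where i: "window x p i = w" using assms(2) by blast
  \<comment> \<open>The summand \<open>a * (n - 1)\<close> plays the role of \<open>- a\<close>
    modulo \<open>n\<close>, undoing the shift within the natural numbers.\<close>
  have "a + (i + a * (n - 1)) = i + a * n"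
    using assms(1) by (cases n) (auto simp: periodic_def)
  then have "[a + (i + a * (n - 1)) = i] (mod n)" by (simp only: cong_def mod_mult_self1)
  then have "window (shift a x) p (i + a * (n - 1)) = w"
    unfolding window_shift using i periodic_window_cong[OF assms(1)] by metis
  then show ?thesis by blast
qed

lemma distinct_windowsI:
  assumes "periodic n x"
    and "\<And>i j. i < n \<Longrightarrow> j < n \<Longrightarrow> window x p i = window x p j \<Longrightarrow> i = j"
  shows "distinct_windows n p x"
  unfolding distinct_windows_def
proof (intro allI impI)
  fix i j assume "window x p i = window x p j"
  then have "window x p (i mod n) = window x p (j mod n)"
    using periodic_window_mod[OF assms(1)] by simp
  then show "[i = j] (mod n)"
    using assms(2)[of "i mod n" "j mod n"] assms(1) by (simp add: cong_def periodic_def)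
qed

lemma distinct_windows_less:
  "distinct_windows n p x \<Longrightarrow> i < n \<Longrightarrow> j < n \<Longrightarrow> window x p i = window x p j \<Longrightarrow> i = j"
  unfolding distinct_windows_def using cong_less_modulus_unique_nat by blast

lemma window_Suc_eqD:
  assumes "window x (Suc q) i = window y (Suc q) j"
  shows "window x q i = window y q j" "window x q (Suc i) = window y q (Suc j)"
  using assms by (auto simp: window_eq_iff)

lemma glue_window_cases:
  assumes x: "periodic n x" and y: "periodic m y" and "window x p 0 = window y p 0" "q \<le> Suc p"
  obtains j where "window (glue n m x y) q i = window x q j"
    | j where "window (glue n m x y) q i = window y q j"
proof -
  have "0 < n" "0 < m" using x y by (auto simp: periodic_def)
  then have "periodic (n + m) (glue n m x y)" by (simp add: periodic_glue)
  note mod = periodic_window_mod[OF this, of q i]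
  have "i mod (n + m) < n + m" using \<open>0 < n\<close> by simp
  then show thesis
    using window_glue[OF assms] that mod by (metis less_add_cases)
qed

lemma glue_covers:
  assumes x: "periodic n x" and y: "periodic m y" and "window x p 0 = window y p 0" "q \<le> Suc p"
    and cover: "(\<exists>i. window x q i = w) \<or> (\<exists>i. window y q i = w)"
  shows "\<exists>i. window (glue n m x y) q i = w"
proof -
  have "0 < n" "0 < m" using x y by (auto simp: periodic_def)
  then have *: "i mod n < n" "i mod m < m" for i by auto
  from cover show ?thesis
    using window_glue(1)[OF assms(1-4) *(1)] window_glue(2)[OF assms(1-4) *(2)]
      periodic_window_mod[OF x] periodic_window_mod[OF y] by metis
qed

text \<open>Edge-disjoint closed walks sharing a vertex can be traversed one after the other from
  that vertex; \<open>window_glue\<close> with \<open>p = q\<close> keeps every edge.\<close>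

lemma tour_glue:
  assumes x: "periodic n x" and y: "periodic m y" and eq: "window x q 0 = window y q 0"
    and dx: "distinct_windows n (Suc q) x" and dy: "distinct_windows m (Suc q) y"
    and disj: "\<And>i j. window x (Suc q) i \<noteq> window y (Suc q) j"
    and cover: "\<And>w. length w = q \<Longrightarrow> (\<exists>i. window x q i = w) \<or> (\<exists>i. window y q i = w)"
  shows "tour (n + m) q (glue n m x y)"
proof -
  have n: "0 < n" using x by (auto simp: periodic_def)
  note w = window_glue[OF x y eq order_refl]
  have "distinct_windows (n + m) (Suc q) (glue n m x y)"
  proof (rule distinct_windowsI[OF periodic_glue[OF n]])
    fix i j assume "i < n + m" "j < n + m"
      and *: "window (glue n m x y) (Suc q) i = window (glue n m x y) (Suc q) j"
    then show "i = j"
      using disj[symmetric] disj distinct_windows_less[OF dx] distinct_windows_less[OF dy]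
      by (elim less_add_cases) (auto simp: w)
  qed
  moreover have "\<exists>i. window (glue n m x y) q i = w" if "length w = q" for w
    by (rule glue_covers[OF x y eq _ cover[OF that]]) auto
  ultimately show ?thesis
    using periodic_glue[OF n] by (auto simp: tour_def)
qed

text \<open>Two vertex-disjoint closed walks through \<open>(q + 1)\<close>-words with a common \<open>q\<close>-word can also
  be joined: this trades one edge of each for the two cross edges, which are new because they
  run between the two vertex sets.\<close>

lemma
  assumes x: "periodic n x" and y: "periodic m y" and eq: "window x q 0 = window y q 0"
    and disj: "\<And>i j. window x (Suc q) i \<noteq> window y (Suc q) j"
  shows tour_cross_glue:
    "\<lbrakk>distinct_windows n (Suc (Suc q)) x; distinct_windows m (Suc (Suc q)) y;
      \<And>w. length w = Suc q \<Longrightarrow> (\<exists>i. window x (Suc q) i = w) \<or> (\<exists>i. window y (Suc q) i = w)\<rbrakk>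
     \<Longrightarrow> tour (n + m) (Suc q) (glue n m x y)" (is "PROP ?A")
    and lacks_constant_cross_glue:
    "\<lbrakk>lacks_constant (Suc (Suc q)) c x; lacks_constant (Suc (Suc q)) c y\<rbrakk>
     \<Longrightarrow> lacks_constant (Suc (Suc q)) c (glue n m x y)" (is "PROP ?B")
proof -
  let ?z = "glue n m x y"
  have n: "0 < n" "0 < m" using x y by (auto simp: periodic_def)
  note per = periodic_glue[OF n(1), of m x y]
  note w = window_glue[OF x y eq order_refl]
  have wn: "window ?z (Suc q) n = window y (Suc q) 0"
    using w(2)[of 0] n by simp
  have wnm: "window ?z (Suc q) (n + m) = window x (Suc q) 0"
    using w(1)[of 0] n periodic_window_mod[OF per, of "Suc q" "n + m"] by simp
  \<comment> \<open>With only \<open>q\<close> common bits, an edge is inherited unless it starts at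
    the last position of a block. The two exceptions are the cross edges, whose ends are given by
    \<open>wn\<close> and \<open>wnm\<close>.\<close>
  have zx: "window ?z (Suc (Suc q)) i = window x (Suc (Suc q)) i" if "Suc i < n" for i
    using glue_eq(1)[OF x y eq] that by (auto simp: window_eq_iff)
  have zy: "window ?z (Suc (Suc q)) (n + i) = window y (Suc (Suc q)) i" if "Suc i < m" for i
    using glue_eq(2)[OF x y eq] that by (auto simp: window_eq_iff add.assoc)
  have last: "Suc i < n \<or> Suc i = n" if "i < n" for i n :: nat using that by auto
  show "PROP ?A"
  proof -
    assume dx: "distinct_windows n (Suc (Suc q)) x" and dy: "distinct_windows m (Suc (Suc q)) y"
      and cover: "\<And>w. length w = Suc q \<Longrightarrow> (\<exists>i. window x (Suc q) i = w) \<or> (\<exists>i. window y (Suc q) i = w)"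
    have "distinct_windows (n + m) (Suc (Suc q)) ?z"
    proof (rule distinct_windowsI[OF per])
      fix i j assume i: "i < n + m" and j: "j < n + m"
        and e: "window ?z (Suc (Suc q)) i = window ?z (Suc (Suc q)) j"
      note e' = window_Suc_eqD[OF e]
      \<comment> \<open>Positions in different blocks have their \<open>Suc q\<close>-words in
        different vertex sets. Within one block, if exactly one position is the last, the words one
        step later lie in different sets.\<close>
      show "i = j"
      proof (cases rule: less_add_cases[OF i]; cases rule: less_add_cases[OF j])
        assume ij: "i < n" "j < n"
        then consider "Suc i < n" "Suc j < n" | "Suc i = n" "Suc j = n"
          | "Suc i < n" "Suc j = n" | "Suc i = n" "Suc j < n" using last by metis
        then show ?thesis
        proof cases
          case 1
          then show ?thesis using e distinct_windows_less[OF dx] by (simp add: zx)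
        next
          case 3
          then show ?thesis using e'(2) disj wn w(1) by metis
        next
          case 4
          then show ?thesis using e'(2) disj wn w(1) by metis
        qed simp
      next
        fix k l assume ij: "i = n + k" "k < m" "j = n + l" "l < m"
        then consider "Suc k < m" "Suc l < m" | "Suc k = m" "Suc l = m"
          | "Suc k < m" "Suc l = m" | "Suc k = m" "Suc l < m" using last by metis
        then show ?thesis
        proof cases
          case 1
          then show ?thesis using e distinct_windows_less[OF dy] ij by (simp add: zy)
        next
          case 3
          then show ?thesis using e'(2) disj wnm w(2) ij by (metis add_Suc_right)
        next
          case 4
          then show ?thesis using e'(2) disj wnm w(2) ij by (metis add_Suc_right)
        qed (use ij in simp)
      qed (use e'(1) disj w in metis)+
    qed
    moreover have "\<exists>i. window ?z (Suc q) i = w" if "length w = Suc q" for w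
      by (rule glue_covers[OF x y eq _ cover[OF that]]) auto
    ultimately show ?thesis
      using per by (auto simp: tour_def)
  qed
  show "PROP ?B"
  proof -
    assume l: "lacks_constant (Suc (Suc q)) c x" "lacks_constant (Suc (Suc q)) c y"
    have "window ?z (Suc (Suc q)) i \<noteq> replicate (Suc (Suc q)) c" if i: "i < n + m" for i
    proof
      assume "window ?z (Suc (Suc q)) i = replicate (Suc (Suc q)) c"
      then have e: "window ?z (Suc (Suc q)) i = window (\<lambda>_. c) (Suc (Suc q)) i"
        unfolding window_eq_replicate_iff window_eq_iff by simp
      \<comment> \<open>A constant edge is a loop, so its two \<open>Suc q\<close>-words coincide.
        Inherited edges are not constant by assumption, and a cross edge has its ends in disjoint
        vertex sets.\<close>
      have "window (\<lambda>_. c) (Suc q) (Suc i) = window (\<lambda>_. c) (Suc q) i"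
        by (simp add: window_eq_iff)
      then have e': "window ?z (Suc q) i = window ?z (Suc q) (Suc i)"
        using window_Suc_eqD[OF e] by simp
      have lw: "window x (Suc (Suc q)) j \<noteq> window (\<lambda>_. c) (Suc (Suc q)) i"
        "window y (Suc (Suc q)) j \<noteq> window (\<lambda>_. c) (Suc (Suc q)) i" for j
        using l unfolding lacks_constant_def window_eq_replicate_iff window_eq_iff by auto
      from i show False
      proof (cases rule: less_add_cases)
        case 1
        then show False using last[OF 1] e e' zx lw w wn disj by metis
      next
        case (2 j)
        then show False using last[OF 2(2)] e e' zy lw w wnm disj by (metis add_Suc_right)
      qed
    qed
    moreover have "i mod (n + m) < n + m" for i using n by simp
    ultimately show ?thesis
      unfolding lacks_constant_def using periodic_window_mod[OF per] by metis
  qed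
qed


section \<open>Lifting closed walks through Lempel's homomorphism\<close>

text \<open>The two preimages of \<open>s\<close> under Lempel's map, which sends \<open>x\<close> to \<open>x i + x (i + 1)\<close>
  modulo 2.\<close>

primrec lift :: "bool \<Rightarrow> (nat \<Rightarrow> bool) \<Rightarrow> nat \<Rightarrow> bool" where
  "lift c s 0 = c"
| "lift c s (Suc i) = (lift c s i \<noteq> s i)"

lemma lift_True: "lift True s i = (\<not> lift False s i)"
  by (induction i) auto

text \<open>The bit \<open>lift False s m\<close> is the parity of the ones in a period of
  \<open>s\<close>: if odd, each period complements the lift; if even, the lift has period
  \<open>m\<close> itself.\<close>

lemma lift_add: "periodic m s \<Longrightarrow> lift c s (m + i) = (lift c s i \<noteq> lift False s m)"
proof (induction i)
  case 0
  show ?case by (cases c) (auto simp: lift_True)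
next
  case (Suc i)
  then show ?case by (auto simp: periodic_def add.commute)
qed

text \<open>Adjacent bits of the lift differ exactly where \<open>s\<close> is true, so a lifted
  word amounts to its first bit together with a word of \<open>s\<close> one bit shorter.\<close>

lemma window_lift_eqD:
  assumes "window (lift c s) (Suc p) i = window (lift d s) (Suc p) j"
  shows "window s p i = window s p j" "lift c s i = lift d s j"
proof -
  have *: "lift c s (i + k) = lift d s (j + k)" if "k \<le> p" for k
    using assms that by (auto simp: window_eq_iff)
  have "s (i + k) = s (j + k)" if "k < p" for k
    using *[of k] *[of "Suc k"] that by auto
  then show "window s p i = window s p j" by (simp add: window_eq_iff)
  show "lift c s i = lift d s j"
    using *[of 0] by simp
qed

lemma lift_covers:
  assumes s: "tour m q s" and w: "length w = Suc q"
  obtains c i where "window (lift c s) (Suc q) i = w"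
proof -
  have "length (map (\<lambda>k. w ! k \<noteq> w ! Suc k) [0..<q]) = q" by simp
  then obtain i where "window s q i = map (\<lambda>k. w ! k \<noteq> w ! Suc k) [0..<q]"
    using s unfolding tour_def by blast
  then have i: "s (i + k) = (w ! k \<noteq> w ! Suc k)" if "k < q" for k
    using that by (simp add: window_eq_list_iff)
  \<comment> \<open>Switching \<open>c\<close> complements the whole lift, so it can be made to read
    \<open>w ! 0\<close> at position \<open>i\<close>; the differences then force the other
    bits.\<close>
  define c where "c = (lift False s i \<noteq> w ! 0)"
  have "k < Suc q \<Longrightarrow> lift c s (i + k) = w ! k" for k
  proof (induction k)
    case 0
    show ?case by (cases c) (auto simp: c_def lift_True)
  next
    case (Suc k)
    then show ?case using i[of k] by auto
  qed
  then have "window (lift c s) (Suc q) i = w"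
    using w by (simp add: window_eq_list_iff)
  then show thesis by (rule that)
qed

text \<open>Constant words of either bit have only zero differences, so the absence of a single word
  from \<open>s\<close> excludes both constants from the lift.\<close>

lemma lacks_constant_lift:
  assumes "lacks_constant p False s"
  shows "lacks_constant (Suc p) c (lift d s)"
proof -
  have False if "\<forall>k<Suc p. lift d s (i + k) = c" for i
  proof -
    have "\<not> s (i + k)" if "k < p" for k
    proof -
      have "k < Suc p" "Suc k < Suc p" using that by auto
      with \<open>\<forall>k<Suc p. lift d s (i + k) = c\<close>
      have "lift d s (i + k) = c" "lift d s (i + Suc k) = c"
        by blast+
      then show ?thesis by auto
    qed
    then show False using assms by (auto simp: lacks_constant_def window_eq_replicate_iff)
  qed
  then show ?thesis unfolding lacks_constant_def window_eq_replicate_iff by blast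
qed

lemma lacks_constant_shift: "lacks_constant p c x \<Longrightarrow> lacks_constant p c (shift a x)"
  by (simp add: lacks_constant_def window_shift)

lemma lacks_constant_glue:
  assumes "periodic n x" "periodic m y" "window x p 0 = window y p 0" "q \<le> Suc p"
    and "lacks_constant q c x" "lacks_constant q c y"
  shows "lacks_constant q c (glue n m x y)"
  unfolding lacks_constant_def using glue_window_cases[OF assms(1-4)] assms(5,6)
  by (metis lacks_constant_def)

text \<open>For odd parity the lift is one cycle whose second half complements the first. This gives
  the balance, and it separates positions \<open>i\<close> and \<open>m + i\<close> by their
  bits.\<close>

lemma tour_lift:
  assumes s: "tour m q s" and odd: "lift False s m"
  shows "tour (2 * m) (Suc q) (lift False s)" "bit_balanced (2 * m) (lift False s)"
proof -
  let ?x = "lift False s"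
  have per: "periodic m s" and ds: "distinct_windows m (Suc q) s" and m: "0 < m"
    using s by (auto simp: tour_def periodic_def)
  have flip: "?x (m + i) = (\<not> ?x i)" for i using lift_add[OF per] odd by simp
  have "?x (i + (m + m)) = ?x i" for i
    using flip[of "m + i"] flip[of i] by (simp add: ac_simps)
  then have per2: "periodic (m + m) ?x" using m by (simp add: periodic_def)
  have "distinct_windows (m + m) (Suc (Suc q)) ?x"
  proof (rule distinct_windowsI[OF per2])
    fix i j assume ij: "i < m + m" "j < m + m" and "window ?x (Suc (Suc q)) i = window ?x (Suc (Suc q)) j"
    then have "window s (Suc q) i = window s (Suc q) j" and x: "?x i = ?x j"
      using window_lift_eqD[of False s "Suc q" i False j] by auto
    then have "[i = j] (mod m)" using ds by (simp add: distinct_windows_def)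
    then have "i mod m = j mod m" by (simp add: cong_def)
    with ij x show "i = j"
      by (elim less_add_cases) (auto simp: flip)
  qed
  moreover have "\<exists>i. window ?x (Suc q) i = w" if "length w = Suc q" for w
  proof -
    obtain c i where i: "window (lift c s) (Suc q) i = w"
      by (rule lift_covers[OF s \<open>length w = Suc q\<close>])
    \<comment> \<open>The preimage starting with \<open>True\<close> is the same cycle moved by half
      its length.\<close>
    have "window ?x (Suc q) (if c then m + i else i) = window (lift c s) (Suc q) i"
      by (cases c) (auto simp: window_eq_iff add.assoc flip lift_True)
    with i show ?thesis by metis
  qed
  ultimately show "tour (2 * m) (Suc q) ?x" using per2 by (simp add: tour_def mult_2)
  show "bit_balanced (2 * m) ?x"
    using card_compl[of m ?x] by (simp add: bit_balanced_def mult_2 card_less_add flip)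
qed

text \<open>A path in the de Bruijn graph from a vertex of \<open>x\<close> to one of
  \<open>y\<close> leaves the vertices of \<open>x\<close> at some step. The vertex reached there
  lies on \<open>y\<close> by covering, and it overlaps its predecessor in \<open>q\<close>
  bits.\<close>

lemma exists_common_window:
  assumes cover: "\<And>w. length w = Suc q \<Longrightarrow> (\<exists>i. window x (Suc q) i = w) \<or> (\<exists>i. window y (Suc q) i = w)"
    and disj: "\<And>i j. window x (Suc q) i \<noteq> window y (Suc q) j"
  obtains i j where "window x q i = window y q j"
proof -
  \<comment> \<open>The sequence \<open>g\<close> spells such a path, from the first
    \<open>q + 1\<close> bits of \<open>x\<close> to those of \<open>y\<close>.\<close>
  define g where "g k = (if k < Suc q then x k else y (k - Suc q))" for k
  let ?P = "\<lambda>r. \<exists>i. window g (Suc q) r = window x (Suc q) i"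
  have 0: "?P 0" by (rule exI[of _ 0]) (auto simp: g_def window_eq_iff)
  have "window g (Suc q) (Suc q) = window y (Suc q) 0" by (auto simp: g_def window_eq_iff)
  then have "\<not> ?P (Suc q)" using disj by metis
  with 0 obtain r where r: "?P r" "\<not> ?P (Suc r)" using nat_induct[of ?P] by blast
  from r(1) obtain i where i: "window g (Suc q) r = window x (Suc q) i" by blast
  from r(2) have "window x (Suc q) k \<noteq> window g (Suc q) (Suc r)" for k by metis
  then obtain j where "window g (Suc q) (Suc r) = window y (Suc q) j"
    using cover[of "window g (Suc q) (Suc r)"] length_window by metis
  with i have "window x q (Suc i) = window y q j"
    using window_Suc_eqD(2)[of g q r x i] window_Suc_eqD(1)[of g q "Suc r" y j] by simp
  then show thesis by (rule that)
qed

lemma tour_double: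
  assumes s: "tour m q s"
  shows "\<exists>z. tour (2 * m) (Suc q) z \<and> bit_balanced (2 * m) z \<and>
    (lacks_constant (Suc q) False s \<longrightarrow> (\<forall>c. lacks_constant (Suc (Suc q)) c z))"
proof (cases "lift False s m")
  case True
  have "lacks_constant (Suc q) False s \<longrightarrow> (\<forall>c. lacks_constant (Suc (Suc q)) c (lift False s))"
    using lacks_constant_lift by blast
  then show ?thesis using tour_lift[OF s True] by blast
next
  case False
  define x where "x c = lift c s" for c
  have per: "periodic m s" and ds: "distinct_windows m (Suc q) s" and m: "0 < m"
    using s by (auto simp: tour_def periodic_def)
  have px: "periodic m (x c)" for c
    using m lift_add[OF per] False by (simp add: periodic_def x_def add.commute[of _ m])
  \<comment> \<open>The two lifts differ at every position, so the first bit identifies the lift.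
    The case \<open>c = d\<close> gives distinct edges in each cycle, the case
    \<open>c \<noteq> d\<close> edge-disjoint cycles.\<close>
  have x_eq: "[i = j] (mod m) \<and> c = d"
    if "window (x c) (Suc (Suc q)) i = window (x d) (Suc (Suc q)) j" for c d i j
  proof -
    have 1: "window s (Suc q) i = window s (Suc q) j" and 2: "x c i = x d j"
      using window_lift_eqD[of c s "Suc q" i d j] that by (simp_all add: x_def)
    from 1 have c: "[i = j] (mod m)" using ds by (simp add: distinct_windows_def)
    then have "x d i = x d j" by (rule periodic_cong[OF px])
    with 2 have "x c i = x d i" by simp
    then have "c = d" by (cases c; cases d) (auto simp: x_def lift_True)
    with c show ?thesis by simp
  qed
  have dx: "distinct_windows m (Suc (Suc q)) (x c)" for c
    using x_eq by (auto simp: distinct_windows_def)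
  have cover: "(\<exists>i. window (x False) (Suc q) i = w) \<or> (\<exists>i. window (x True) (Suc q) i = w)"
    if w: "length w = Suc q" for w
  proof -
    obtain c i where "window (lift c s) (Suc q) i = w"
      by (rule lift_covers[OF s w])
    then show ?thesis by (cases c) (auto simp: x_def)
  qed
  have cover_shift: "(\<exists>i. window (shift a (x False)) (Suc q) i = w) \<or>
      (\<exists>i. window (shift b (x True)) (Suc q) i = w)"
    if w: "length w = Suc q" for w a b
    using cover[OF w]
  proof
    assume "\<exists>i. window (x False) (Suc q) i = w"
    then show ?thesis using window_shift_covers[OF px] by blast
  next
    assume "\<exists>i. window (x True) (Suc q) i = w"
    then show ?thesis using window_shift_covers[OF px] by blast
  qed
  have bal: "bit_balanced (2 * m) (glue m m (shift i (x False)) (shift j (x True)))" for i j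
    using card_compl[of m "lift False s"]
    by (simp add: bit_balanced_def mult_2 card_glue card_shift px) (simp add: x_def lift_True)
  have lx: "lacks_constant (Suc (Suc q)) c (shift a (x d))" if "lacks_constant (Suc q) False s" for a c d
    using lacks_constant_shift[OF lacks_constant_lift[OF that]] by (simp add: x_def)
  show ?thesis
  proof (cases "\<exists>i j. window (x False) (Suc q) i = window (x True) (Suc q) j")
    case True
    then obtain i j where "window (x False) (Suc q) i = window (x True) (Suc q) j" by blast
    then have eq: "window (shift i (x False)) (Suc q) 0 = window (shift j (x True)) (Suc q) 0"
      by (simp add: window_shift)
    let ?z = "glue m m (shift i (x False)) (shift j (x True))"
    have "tour (m + m) (Suc q) ?z"
      using x_eq cover_shift by (intro tour_glue periodic_shift distinct_windows_shift px dx eq)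
        (auto simp: window_shift)
    moreover have "lacks_constant (Suc (Suc q)) c ?z" if "lacks_constant (Suc q) False s" for c
      by (rule lacks_constant_glue[OF periodic_shift[OF px] periodic_shift[OF px] eq _ lx[OF that] lx[OF that]]) auto
    ultimately show ?thesis using bal[of i j] by (metis mult_2)
  next
    case False
    then have disj: "window (x False) (Suc q) i \<noteq> window (x True) (Suc q) j" for i j by blast
    obtain i j where "window (x False) q i = window (x True) q j"
      using exists_common_window[OF cover disj] by blast
    then have eq: "window (shift i (x False)) q 0 = window (shift j (x True)) q 0"
      by (simp add: window_shift)
    let ?z = "glue m m (shift i (x False)) (shift j (x True))"
    have disj': "window (shift i (x False)) (Suc q) k \<noteq> window (shift j (x True)) (Suc q) l" for k l
      using disj by (simp add: window_shift)
    note cross = periodic_shift[OF px] periodic_shift[OF px] eq disj'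
    have "tour (m + m) (Suc q) ?z"
      using cover_shift
      by (intro tour_cross_glue[OF cross] distinct_windows_shift dx) auto
    moreover have "lacks_constant (Suc (Suc q)) c ?z" if "lacks_constant (Suc q) False s" for c
      by (rule lacks_constant_cross_glue[OF cross lx[OF that] lx[OF that]])
    ultimately show ?thesis using bal[of i j] by (metis mult_2)
  qed
qed

text \<open>The missing zero window is carried through the induction: lifting turns it into two
  missing constants, and an odd length spends only the all-true one. At \<open>m = 2 ^ Suc q\<close>
  every word occurs, hence the strict bound.\<close>

theorem exists_tour:
  assumes "2 ^ q \<le> m" "m \<le> 2 ^ Suc q"
  shows "\<exists>x. tour m q x \<and> (m < 2 ^ Suc q \<longrightarrow> lacks_constant (Suc q) False x) \<and>
    (even m \<longrightarrow> bit_balanced m x)"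
  using assms
proof (induction q arbitrary: m)
  case 0
  \<comment> \<open>For \<open>q = 0\<close> the only vertex is the empty word, and the two bits are
    its loops.\<close>
  then consider "m = 1" | "m = 2" by fastforce
  then show ?case
  proof cases
    case 1
    have "tour m 0 (\<lambda>_. True)" "lacks_constant (Suc 0) False (\<lambda>_. True)"
      using 1 by (auto simp: tour_def periodic_def distinct_windows_def cong_def lacks_constant_def
          window_eq_replicate_iff window_eq_list_iff)
    then show ?thesis using 1 by auto
  next
    case 2
    have "distinct_windows 2 (Suc 0) even"
      by (auto simp: distinct_windows_def window_eq_iff cong_def even_iff_mod_2_eq_zero)
    then have "tour m 0 even"
      using 2 by (auto simp: tour_def periodic_def window_eq_list_iff)
    moreover have "{i::nat. i < 2 \<and> even i} = {0}"
      by (auto simp: less_2_cases_iff)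
    then have "bit_balanced m even" using 2 by (simp add: bit_balanced_def)
    ultimately show ?thesis using 2 by auto
  qed
next
  case (Suc q)
  define t where "t = m div 2"
  have t: "2 ^ q \<le> t" "t \<le> 2 ^ Suc q" using Suc.prems by (auto simp: t_def)
  obtain s where s: "tour t q s" "t < 2 ^ Suc q \<Longrightarrow> lacks_constant (Suc q) False s"
    using Suc.IH[OF t] by blast
  obtain z where z: "tour (2 * t) (Suc q) z" "bit_balanced (2 * t) z"
    "t < 2 ^ Suc q \<Longrightarrow> lacks_constant (Suc (Suc q)) c z" for c
    using tour_double[OF s(1)] s(2) by metis
  show ?case
  proof (cases "even m")
    case True
    then have m: "m = 2 * t" by (simp add: t_def)
    then have "t < 2 ^ Suc q" if "m < 2 ^ Suc (Suc q)" using that by simp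
    then show ?thesis using z m by metis
  next
    case False
    then have m: "m = 2 * t + 1" by (simp add: t_def)
    then have lacks: "lacks_constant (Suc (Suc q)) c z" for c
      using z(3) Suc.prems(2) by simp
    have pz: "periodic (2 * t) z" and dz: "distinct_windows (2 * t) (Suc (Suc q)) z"
      and cz: "\<And>w. length w = Suc q \<Longrightarrow> \<exists>i. window z (Suc q) i = w"
      using z(1) by (auto simp: tour_def)
    obtain a where a: "window z (Suc q) a = replicate (Suc q) True"
      using cz[of "replicate (Suc q) True"] by auto
    \<comment> \<open>Insert the loop at the all-true vertex; \<open>z\<close> lacks it because an
      odd \<open>m\<close> is strictly below \<open>2 ^ Suc (Suc q)\<close>.\<close>
    let ?x = "shift a z" and ?y = "\<lambda>_. True"
    have "window (\<lambda>_. True) (Suc q) 0 = replicate (Suc q) True"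
      by (simp only: window_eq_replicate_iff) simp
    then have eq: "window ?x (Suc q) 0 = window ?y (Suc q) 0"
      using a by (simp add: window_shift)
    have py: "periodic 1 ?y" by (simp add: periodic_def)
    have const: "window ?y (Suc (Suc q)) i = replicate (Suc (Suc q)) True" for i
      by (simp only: window_eq_replicate_iff) simp
    have lx: "lacks_constant (Suc (Suc q)) c ?x" for c
      by (rule lacks_constant_shift[OF lacks])
    have ly: "lacks_constant (Suc (Suc q)) False ?y"
      unfolding lacks_constant_def const by simp
    have "tour (2 * t + 1) (Suc q) (glue (2 * t) 1 ?x ?y)"
    proof (rule tour_glue[OF periodic_shift[OF pz] py eq distinct_windows_shift[OF dz]])
      show "distinct_windows 1 (Suc (Suc q)) ?y"
        by (simp add: distinct_windows_def cong_def)
      show "window ?x (Suc (Suc q)) i \<noteq> window ?y (Suc (Suc q)) j" for i j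
        using lx[of True] unfolding const lacks_constant_def by blast
      show "(\<exists>i. window ?x (Suc q) i = w) \<or> (\<exists>i. window ?y (Suc q) i = w)"
        if "length w = Suc q" for w
        using window_shift_covers[OF pz cz[OF that]] by blast
    qed
    moreover have "lacks_constant (Suc (Suc q)) False (glue (2 * t) 1 ?x ?y)"
      by (rule lacks_constant_glue[OF periodic_shift[OF pz] py eq order_refl lx ly])
    ultimately show ?thesis using m False by blast
  qed
qed

section \<open>Balanced sequences with bounded multiplicities\<close>

lemma distinct_windows_mono:
  assumes "distinct_windows n p x" "p \<le> q"
  shows "distinct_windows n q x"
  using assms by (auto simp: distinct_windows_def window_eq_iff)

lemma card_window_le_1:
  assumes "distinct_windows n p x"
  shows "card {i. i < n \<and> window x p i = w} \<le> 1"
  unfolding card_le_Suc0_iff_eq[OF finite_Collect_conjI[OF disjI1[OF finite_Collect_less_nat]]] One_nat_def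
  using distinct_windows_less[OF assms] by auto

lemma exists_balanced_distinct:
  assumes "even n" "0 < n" "n \<le> 2 ^ l"
  shows "\<exists>x. periodic n x \<and> distinct_windows n l x \<and> bit_balanced n x"
proof -
  let ?P = "\<lambda>q. n \<le> 2 ^ Suc q"
  \<comment> \<open>Minimality of \<open>q\<close> supplies the lower bound
    \<open>2 ^ q \<le> n\<close> required by \<open>exists_tour\<close>; distinctness then passes to
    the longer \<open>l\<close>-windows.\<close>
  define q where "q = (LEAST q. ?P q)"
  have l: "l \<noteq> 0" using assms by (cases "l = 0") auto
  then have P: "?P (l - 1)" using assms by simp
  have "?P q" unfolding q_def by (rule LeastI[of ?P, OF P])
  moreover have "q \<le> l - 1" unfolding q_def by (rule Least_le[of ?P, OF P])
  moreover have "2 ^ q \<le> n"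
  proof (cases q)
    case (Suc r)
    then have "\<not> ?P r" using not_less_Least[of r ?P] by (simp add: q_def)
    then show ?thesis using Suc by simp
  qed (use assms in simp)
  ultimately obtain x where "tour n q x" "bit_balanced n x"
    using exists_tour[of q n] assms by blast
  moreover have "Suc q \<le> l" using \<open>q \<le> l - 1\<close> l by simp
  ultimately show ?thesis
    using distinct_windows_mono by (auto simp: tour_def)
qed

text \<open>Splicing in a full de Bruijn sequence of length \<open>2 ^ l\<close> raises each
  multiplicity by at most one, so \<open>k\<close> grows by one while \<open>n\<close> grows by
  \<open>2 ^ l\<close>.\<close>

lemma exists_balanced_bounded:
  assumes "even n" "0 < n" "0 < l" "n \<le> k * 2 ^ l"
  shows "\<exists>x. periodic n x \<and> bit_balanced n x \<and> (\<forall>w. card {i. i < n \<and> window x l i = w} \<le> k)"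
  using assms
proof (induction k arbitrary: n)
  case (Suc k)
  show ?case
  proof (cases "n \<le> 2 ^ l")
    case True
    then obtain x where x: "periodic n x" "distinct_windows n l x" "bit_balanced n x"
      using exists_balanced_distinct Suc.prems by blast
    have "card {i. i < n \<and> window x l i = w} \<le> Suc k" for w
      using card_window_le_1[OF x(2), of w] by simp
    with x show ?thesis by blast
  next
    case False
    define r where "r = n - 2 ^ l"
    obtain q where l: "l = Suc q" using Suc.prems by (cases l) auto
    have n: "n = 2 ^ l + r" and r: "0 < r" "r \<le> k * 2 ^ l" "even r"
      using False Suc.prems by (auto simp: r_def)
    obtain y where y: "periodic r y" "bit_balanced r y"
      "\<And>w. card {i. i < r \<and> window y l i = w} \<le> k"
      using Suc.IH[OF r(3,1) Suc.prems(3) r(2)] by blast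
    obtain x where x: "tour (2 ^ l) q x" "bit_balanced (2 ^ l) x"
      using exists_tour[of q "2 ^ l"] l by auto
    then have px: "periodic (2 ^ l) x" and dx: "distinct_windows (2 ^ l) l x"
      using l by (auto simp: tour_def)
    \<comment> \<open>The full sequence contains every \<open>q\<close>-word, so it can be rotated
      to start like \<open>y\<close>; \<open>q = l - 1\<close> common bits suffice to keep all
      \<open>l\<close>-windows.\<close>
    obtain a where "window x q a = window y q 0"
      using x(1) length_window unfolding tour_def by metis
    then have eq: "window (shift a x) q 0 = window y q 0" by (simp add: window_shift)
    let ?z = "glue (2 ^ l) r (shift a x) y"
    have "card {i. i < n \<and> window ?z l i = w} \<le> Suc k" for w
    proof -
      have "card {i. i < n \<and> window ?z l i = w} =
          card {i. i < 2 ^ l \<and> window (shift a x) l i = w} + card {i. i < r \<and> window y l i = w}"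
        unfolding n by (rule card_glue_windows[OF periodic_shift[OF px] y(1) eq]) (simp add: l)
      then show ?thesis
        using y(3)[of w] card_window_le_1[OF distinct_windows_shift[OF dx], of a w] by simp
    qed
    moreover have "periodic n ?z" unfolding n by (rule periodic_glue) simp
    moreover have "bit_balanced n ?z"
      using x(2) y(2) unfolding n bit_balanced_def card_glue by (simp add: card_shift[OF px])
    ultimately show ?thesis by blast
  qed
qed simp

section \<open>Translation to lists, and the necessary conditions\<close>

lemma count_list_map_upt: "count_list (map x [0..<n]) c = card {i. i < n \<and> x i = c}"
proof (induction n)
  case (Suc n)
  have "{i. i < Suc n \<and> x i = c} = (if x n = c then insert n {i. i < n \<and> x i = c} else {i. i < n \<and> x i = c})"
    by (auto simp: less_Suc_eq)
  then show ?case using Suc by simp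
qed simp

lemma cyclic_window_map_upt:
  assumes "periodic n x"
  shows "cyclic_window (map x [0..<n]) l i = window x l i"
proof -
  have "x ((i + j) mod n) = x (i + j)" for j
    using periodic_cong[OF assms, of "(i + j) mod n" "i + j"] by (simp add: cong_def)
  then show ?thesis
    using assms by (simp add: cyclic_window_def window_def periodic_def)
qed

text \<open>Pigeonhole: the \<open>n\<close> starting positions are sorted by their windows into
  \<open>2 ^ l\<close> classes of size at most \<open>k\<close>.\<close>

lemma generalized_de_bruijn_length_le:
  assumes "generalized_de_bruijn n l k b"
  shows "n \<le> k * 2 ^ l"
proof -
  let ?W = "{w :: bool list. length w = l}"
  have W: "finite ?W" "card ?W = 2 ^ l"
    using finite_lists_length_eq[of "UNIV :: bool set" l] card_lists_length_eq[of "UNIV :: bool set" l]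
    by auto
  have "{..<n} = (\<Union>w\<in>?W. {i. i < n \<and> cyclic_window b l i = w})"
    by (auto simp: cyclic_window_def)
  then have "n = card (\<Union>w\<in>?W. {i. i < n \<and> cyclic_window b l i = w})"
    by (metis card_lessThan)
  also have "\<dots> \<le> (\<Sum>w\<in>?W. card {i. i < n \<and> cyclic_window b l i = w})"
    by (rule card_UN_le[OF W(1)])
  also have "\<dots> \<le> (\<Sum>w\<in>?W. k)"
    by (rule sum_mono) (use assms in \<open>simp add: generalized_de_bruijn_def\<close>)
  also have "\<dots> = k * 2 ^ l" using W by simp
  finally show ?thesis .
qed

lemma balanced_even_length: "balanced b \<Longrightarrow> even (length b)"
proof -
  have "count_list b False + count_list b True = length b" by (induction b) auto
  then show "balanced b \<Longrightarrow> even (length b)" unfolding balanced_def by presburger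
qed

theorem theorem1:
  fixes n l k :: nat
  assumes "n > 0" and "l > 0" and "k > 0"
  shows "(\<exists>b. generalized_de_bruijn n l k b \<and> balanced b) \<longleftrightarrow>
         even n \<and> real k \<ge> real n / 2 ^ l"
proof -
  have "real k \<ge> real n / 2 ^ l \<longleftrightarrow> real n \<le> real (k * 2 ^ l)"
    by (simp add: divide_le_eq)
  then have bound: "real k \<ge> real n / 2 ^ l \<longleftrightarrow> n \<le> k * 2 ^ l"
    by (simp only: of_nat_le_iff)
  show ?thesis
  proof
    assume "\<exists>b. generalized_de_bruijn n l k b \<and> balanced b"
    then obtain b where b: "generalized_de_bruijn n l k b" "balanced b" by blast
    then have "length b = n" by (simp add: generalized_de_bruijn_def)
    then show "even n \<and> real k \<ge> real n / 2 ^ l"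
      using generalized_de_bruijn_length_le[OF b(1)] balanced_even_length[OF b(2)] bound by blast
  next
    assume "even n \<and> real k \<ge> real n / 2 ^ l"
    then obtain x where x: "periodic n x" "bit_balanced n x"
      "\<And>w. card {i. i < n \<and> window x l i = w} \<le> k"
      using exists_balanced_bounded[of n l k] assms bound by blast
    let ?b = "map x [0..<n]"
    have "generalized_de_bruijn n l k ?b"
      using x by (simp add: generalized_de_bruijn_def cyclic_window_map_upt)
    moreover have "balanced ?b"
      using x(2) card_compl[of n x]
      unfolding balanced_def count_list_map_upt bit_balanced_def by simp
    ultimately show "\<exists>b. generalized_de_bruijn n l k b \<and> balanced b" by blast
  qed
qed

end
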